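(* For every integer $n \ge 9$, the set $S = \{u_0, u_1, \dots, u_7\}$ is a zero forcing set of the generalized Petersen graph $P(n,3)$. Hence $Z(P(n,3)) \le 8$ for all $n \ge 9$.
   Context: Let $G=(V,E)$ be a finite simple graph. Color a subset $S\subseteq V$ black and the remaining vertices white. Color change rule: a black vertex with exactly one white neighbor forces that neighbor to become black. Iterating this rule starting from $S$ until no further force is possible gives the closure $\mathrm{cl}(S)$. The set $S$ is a zero forcing set of $G$ if $\mathrm{cl}(S)=V$, and the zero forcing number $Z(G)$ is the minimum cardinality of a zero forcing set. For $n\ge 3$ and $1\le k<n/2$, the generalized Petersen graph $P(n,k)$ has the $2n$ vertices $\{u_0,\dots,u_{n-1}\}\cup\{v_0,\dots,v_{n-1}\}$ and edges $u_i\sim u_{i+1}$, $u_i\sim v_i$, and $v_i\sim v_{i+k}$ for all $i$, with indices taken modulo $n$. *)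

theory Defs
  imports "Graph_Theory.Pair_Digraph"
begin

text \<open>A finite simple graph is a \<open>pair_graph\<close>: finite, loop-free, with a symmetric arc set.\<close>

definition white_neighbors :: "'a pair_pre_digraph \<Rightarrow> 'a set \<Rightarrow> 'a \<Rightarrow> 'a set" where
  "white_neighbors G B b = {w \<in> pverts G - B. (b, w) \<in> parcs G}"

inductive force_step :: "'a pair_pre_digraph \<Rightarrow> 'a set \<Rightarrow> 'a set \<Rightarrow> bool" for G where
  force: "\<lbrakk>b \<in> B; white_neighbors G B b = {w}\<rbrakk> \<Longrightarrow> force_step G B (insert w B)"

text \<open>
  The closure is the final black set of a maximal sequence of forces; its existence and
  its independence of the order of the forces are shown in \<open>forcing_final_ex1\<close>.
\<close>

definition forcing_final :: "'a pair_pre_digraph \<Rightarrow> 'a set \<Rightarrow> 'a set \<Rightarrow> bool" where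
  "forcing_final G S B \<longleftrightarrow> (force_step G)\<^sup>*\<^sup>* S B \<and> \<not> (\<exists>C. force_step G B C)"

definition forcing_closure :: "'a pair_pre_digraph \<Rightarrow> 'a set \<Rightarrow> 'a set" where
  "forcing_closure G S = (THE B. forcing_final G S B)"

definition zero_forcing_set :: "'a pair_pre_digraph \<Rightarrow> 'a set \<Rightarrow> bool" where
  "zero_forcing_set G S \<longleftrightarrow> S \<subseteq> pverts G \<and> forcing_closure G S = pverts G"

definition zero_forcing_number :: "'a pair_pre_digraph \<Rightarrow> nat" where
  "zero_forcing_number G = (LEAST m. \<exists>S. zero_forcing_set G S \<and> card S = m)"

lemma forcing_mono: "(force_step G)\<^sup>*\<^sup>* S B \<Longrightarrow> S \<subseteq> B"
  by (induction rule: rtranclp_induct) (auto elim: force_step.cases)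

lemma forcing_subset_final:
  assumes "(force_step G)\<^sup>*\<^sup>* S B" "S \<subseteq> C" "\<not> (\<exists>D. force_step G C D)"
  shows "B \<subseteq> C"
  using assms(1)
proof (induction rule: rtranclp_induct)
  case base
  show ?case by (fact assms(2))
next
  case (step A B)
  from step(2) obtain b w where bw: "b \<in> A" "white_neighbors G A b = {w}" "B = insert w A"
    by (auto elim: force_step.cases)
  have "w \<in> C"
  proof (rule ccontr)
    assume "w \<notin> C"
    with bw step.IH have "white_neighbors G C b = {w}"
      by (auto simp: white_neighbors_def)
    with bw(1) step.IH assms(3) show False by (blast intro: force_step.force)
  qed
  with bw(3) step.IH show ?case by simp
qed

lemma forcing_final_exists:
  assumes "finite (pverts G)"
  shows "\<exists>B. forcing_final G S B"
proof (induction "card (pverts G - S)" arbitrary: S rule: less_induct)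
  case less
  show ?case
  proof (cases "\<exists>C. force_step G S C")
    case True
    then obtain C where C: "force_step G S C" by blast
    then obtain b w where "white_neighbors G S b = {w}" "C = insert w S"
      by (auto elim: force_step.cases)
    then have "w \<in> pverts G - S" "C = insert w S" by (auto simp: white_neighbors_def)
    then have "pverts G - C \<subset> pverts G - S" by auto
    then have "card (pverts G - C) < card (pverts G - S)"
      using assms by (simp add: psubset_card_mono)
    then obtain B where "forcing_final G C B" using less by blast
    then have "forcing_final G S B"
      using C converse_rtranclp_into_rtranclp[of "force_step G" S C B]
      by (simp add: forcing_final_def)
    then show ?thesis by blast
  next
    case False
    then have "forcing_final G S S" by (simp add: forcing_final_def)
    then show ?thesis by blast
  qed
qed

lemma forcing_final_unique: "forcing_final G S B \<Longrightarrow> forcing_final G S C \<Longrightarrow> B = C"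
  using forcing_mono[of G S B] forcing_mono[of G S C]
    forcing_subset_final[of G S B C] forcing_subset_final[of G S C B]
  by (simp add: forcing_final_def subset_antisym)

lemma forcing_final_ex1: "finite (pverts G) \<Longrightarrow> \<exists>!B. forcing_final G S B"
  by (rule ex_ex1I) (erule forcing_final_exists, erule (1) forcing_final_unique)

lemma forcing_closure_eqI: "forcing_final G S B \<Longrightarrow> forcing_closure G S = B"
  unfolding forcing_closure_def by (rule the_equality) (simp_all add: forcing_final_unique)

lemma zero_forcing_set_pverts: "zero_forcing_set G (pverts G)"
proof -
  have "\<not> force_step G (pverts G) C" for C
    by (auto simp: white_neighbors_def elim: force_step.cases)
  then have "forcing_final G (pverts G) (pverts G)" by (simp add: forcing_final_def)
  then show ?thesis by (simp add: zero_forcing_set_def forcing_closure_eqI)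
qed

lemma zero_forcing_number_attained:
  "\<exists>S. zero_forcing_set G S \<and> card S = zero_forcing_number G"
  unfolding zero_forcing_number_def by (rule LeastI_ex) (use zero_forcing_set_pverts in blast)

lemma zero_forcing_number_le: "zero_forcing_set G S \<Longrightarrow> zero_forcing_number G \<le> card S"
  unfolding zero_forcing_number_def by (rule Least_le) blast

datatype petersen_vertex = U nat | V nat

definition petersen_edges :: "nat \<Rightarrow> nat \<Rightarrow> (petersen_vertex \<times> petersen_vertex) set" where
  "petersen_edges n k =
     {(U i, U ((i + 1) mod n)) | i. i < n} \<union>
     {(U i, V i) | i. i < n} \<union>
     {(V i, V ((i + k) mod n)) | i. i < n}"

definition generalized_petersen :: "nat \<Rightarrow> nat \<Rightarrow> petersen_vertex pair_pre_digraph" where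
  "generalized_petersen n k =
     \<lparr>pverts = U ` {..<n} \<union> V ` {..<n}, parcs = petersen_edges n k \<union> (petersen_edges n k)\<inverse>\<rparr>"

lemma pair_graph_generalized_petersen:
  assumes "3 \<le> n" "1 \<le> k" "2 * k < n"
  shows "pair_graph (generalized_petersen n k)"
proof -
  have shift: "(i + j) mod n \<noteq> i" if "i < n" "1 \<le> j" "j < n" for i j
  proof (cases "i + j < n")
    case False
    then have "(i + j) mod n = i + j - n" using that by (simp add: mod_if)
    then show ?thesis using that False by linarith
  qed (use that in simp)
  let ?G = "generalized_petersen n k"
  have verts: "e \<in> petersen_edges n k \<Longrightarrow> fst e \<in> pverts ?G \<and> snd e \<in> pverts ?G" for e
    using assms by (auto simp: petersen_edges_def generalized_petersen_def)
  have loop: "e \<in> petersen_edges n k \<Longrightarrow> fst e \<noteq> snd e" for e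
    using assms shift[of _ 1] shift[of _ k] shift[THEN not_sym, of _ 1] shift[THEN not_sym, of _ k]
    by (auto simp: petersen_edges_def)
  have parcs: "parcs ?G = petersen_edges n k \<union> (petersen_edges n k)\<inverse>"
    by (simp add: generalized_petersen_def)
  have fin: "finite (petersen_edges n k)" by (simp add: petersen_edges_def)
  show ?thesis
  proof
    show "finite (pverts ?G)" by (simp add: generalized_petersen_def)
    show "finite (parcs ?G)" by (simp add: parcs fin)
    show "symmetric ?G"
      by (auto simp: symmetric_def sym_def parcs arcs_ends_def arc_to_ends_def)
    show "fst e \<in> pverts ?G" "snd e \<in> pverts ?G" "fst e \<noteq> snd e" if "e \<in> parcs ?G" for e
      using that verts[of e] verts[of "prod.swap e"] loop[of e] loop[of "prod.swap e"]
      unfolding parcs by (auto simp: converse_iff)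
  qed
qed

end

theory Submission
  imports Defs
begin

text \<open>
  The vertices \<open>u\<^sub>1, \<dots>, u\<^sub>6\<close> force \<open>v\<^sub>1, \<dots>, v\<^sub>6\<close>; then \<open>v\<^sub>3\<close> forces \<open>v\<^sub>0\<close> and \<open>v\<^sub>4\<close> forces \<open>v\<^sub>7\<close>.
  Once all \<open>u\<^sub>i\<close> and \<open>v\<^sub>i\<close> with \<open>i \<le> m\<close> are black, where \<open>m \<ge> 7\<close>, \<open>u\<^sub>m\<close> forces \<open>u\<^bsub>m+1\<^esub>\<close> and
  \<open>v\<^bsub>m-2\<^esub>\<close> forces \<open>v\<^bsub>m+1\<^esub>\<close>, so the black region grows without ever using the cyclic wrap-around.
\<close>

text \<open>If \<open>w\<close> were white it would be the only white neighbor of \<open>b\<close>,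
  so one more force would be possible. Reasoning inside a final set in this way avoids building an
  explicit sequence of forces.\<close>

lemma forcing_finalD:
  assumes "forcing_final G S B" "b \<in> B" "w \<in> pverts G" "(b, w) \<in> parcs G"
    and "\<And>x. (b, x) \<in> parcs G \<Longrightarrow> x = w \<or> x \<in> B"
  shows "w \<in> B"
proof (rule ccontr)
  assume "w \<notin> B"
  then have "white_neighbors G B b = {w}"
    using assms by (auto simp: white_neighbors_def)
  with assms show False
    by (auto simp: forcing_final_def intro: force_step.force)
qed

text \<open>The full vertex set admits no force, so \<open>forcing_subset_final\<close> applies to
  it.\<close>

lemma forcing_final_subset_pverts:
  assumes "forcing_final G S B" "S \<subseteq> pverts G"
  shows "B \<subseteq> pverts G"
proof -
  have "\<not> (\<exists>C. force_step G (pverts G) C)"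
    by (auto simp: white_neighbors_def elim: force_step.cases)
  with assms show ?thesis
    by (auto simp: forcing_final_def dest: forcing_subset_final)
qed

text \<open>If \<open>j + k\<close> wraps around, its residue \<open>j + k - n\<close> is below
  \<open>k\<close>, hence differs from \<open>i\<close>. This inverts the index shift and so locates
  the neighbor reached through a reversed arc.\<close>

lemma eq_mod_add_iff:
  fixes i j k n :: nat
  assumes "k \<le> i" "i < n"
  shows "i = (j + k) mod n \<and> j < n \<longleftrightarrow> j = i - k"
proof (cases "j < n \<and> n \<le> j + k")
  case True
  then have "(j + k) mod n = (j + k - n) mod n" by (simp add: le_mod_geq)
  also have "\<dots> = j + k - n" using assms True by (intro mod_less) linarith
  finally have "(j + k) mod n = j + k - n" .
  then show ?thesis using assms True by linarith
next
  case False
  then show ?thesis using assms by auto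
qed

lemma pverts_generalized_petersen [simp]:
  "U i \<in> pverts (generalized_petersen n k) \<longleftrightarrow> i < n"
  "V i \<in> pverts (generalized_petersen n k) \<longleftrightarrow> i < n"
  by (auto simp: generalized_petersen_def)

text \<open>The bounds on \<open>i\<close> keep both cyclic neighbors clear of the wrap-around, so
  no \<open>mod\<close> remains.\<close>

lemma outer_neighbor_iff:
  assumes "1 \<le> i" "i + 1 < n"
  shows "(U i, x) \<in> parcs (generalized_petersen n k) \<longleftrightarrow> x \<in> {U (i - 1), U (i + 1), V i}"
proof -
  have iff: "i = Suc j mod n \<and> j < n \<longleftrightarrow> j = i - 1" for j
    using eq_mod_add_iff[of 1 i n j] assms by simp
  show ?thesis
  proof (cases x)
    case (U j)
    then show ?thesis
      using assms by (simp add: generalized_petersen_def petersen_edges_def iff) blast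
  next
    case (V j)
    then show ?thesis
      using assms by (simp add: generalized_petersen_def petersen_edges_def)
  qed
qed

lemma inner_neighbor_iff:
  assumes "k \<le> i" "i + k < n"
  shows "(V i, x) \<in> parcs (generalized_petersen n k) \<longleftrightarrow> x \<in> {V (i - k), V (i + k), U i}"
proof -
  have iff: "i = (j + k) mod n \<and> j < n \<longleftrightarrow> j = i - k" for j
    using eq_mod_add_iff[of k i n j] assms by simp
  show ?thesis
  proof (cases x)
    case (U j)
    then show ?thesis
      using assms by (simp add: generalized_petersen_def petersen_edges_def) auto
  next
    case (V j)
    then show ?thesis
      using assms by (simp add: generalized_petersen_def petersen_edges_def iff) blast
  qed
qed

lemma forcing_final_petersen3:
  assumes n: "9 \<le> n" and B: "forcing_final (generalized_petersen n 3) (U ` {0..7}) B"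
  shows "i < n \<Longrightarrow> U i \<in> B \<and> V i \<in> B"
proof -
  let ?G = "generalized_petersen n 3"
  \<comment> \<open>Leaving open which of the three neighbors is \<open>w\<close> lets one fact
    serve both for forces along the outer cycle and for forces from \<open>U i\<close> to
    \<open>V i\<close>.\<close>
  have outer: "w \<in> B" if "U i \<in> B" "1 \<le> i" "i + 1 < n" "w \<in> {U (i - 1), U (i + 1), V i}"
    "{U (i - 1), U (i + 1), V i} - {w} \<subseteq> B" for i w
  proof (rule forcing_finalD[OF B that(1)])
    show "w \<in> pverts ?G" using that(2-4) by auto
    show "(U i, w) \<in> parcs ?G" unfolding outer_neighbor_iff[OF that(2,3)] by (rule that(4))
    show "x = w \<or> x \<in> B" if "(U i, x) \<in> parcs ?G" for x
      using that \<open>_ - {w} \<subseteq> B\<close> unfolding outer_neighbor_iff[OF \<open>_ \<le> i\<close> \<open>i + _ < n\<close>] by blast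
  qed
  have inner: "w \<in> B" if "V i \<in> B" "3 \<le> i" "i + 3 < n" "w \<in> {V (i - 3), V (i + 3), U i}"
    "{V (i - 3), V (i + 3), U i} - {w} \<subseteq> B" for i w
  proof (rule forcing_finalD[OF B that(1)])
    show "w \<in> pverts ?G" using that(2-4) by auto
    show "(V i, w) \<in> parcs ?G" unfolding inner_neighbor_iff[OF that(2,3)] by (rule that(4))
    show "x = w \<or> x \<in> B" if "(V i, x) \<in> parcs ?G" for x
      using that \<open>_ - {w} \<subseteq> B\<close> unfolding inner_neighbor_iff[OF \<open>_ \<le> i\<close> \<open>i + _ < n\<close>] by blast
  qed
  have U: "U j \<in> B" if "j \<le> 7" for j
    using B that by (auto simp: forcing_final_def dest!: forcing_mono)
  \<comment> \<open>Exactly for these \<open>j\<close> do both \<open>j - 1\<close> and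
    \<open>j + 1\<close> stay within the initial indices 0 to 7.\<close>
  have V16: "V j \<in> B" if "1 \<le> j" "j \<le> 6" for j
    by (rule outer[of j]) (use that n in \<open>auto intro: U\<close>)
  have V0: "V 0 \<in> B" by (rule inner[of 3]) (use n in \<open>auto intro: U V16\<close>)
  have V7: "V 7 \<in> B" by (rule inner[of 4]) (use n in \<open>auto intro: U V16\<close>)
  have V: "V j \<in> B" if "j \<le> 7" for j
    using that V0 V7 V16[of j] by (cases "j = 0 \<or> j = 7") auto
  show "i < n \<Longrightarrow> U i \<in> B \<and> V i \<in> B"
  \<comment> \<open>Strong induction is needed because forcing \<open>V i\<close> from
    \<open>V (i - 3)\<close> looks back to \<open>V (i - 6)\<close>.\<close>
  proof (induction i rule: less_induct)
    case (less i)
    show ?case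
    proof (cases "i \<le> 7")
      case False
      have prev: "U j \<in> B" "V j \<in> B" if "j < i" for j
        using less that by auto
      have "U i \<in> B"
        by (rule outer[of "i - 1"]) (use False less.prems in \<open>auto intro: prev\<close>)
      moreover have "V i \<in> B"
        by (rule inner[of "i - 3"]) (use False less.prems in \<open>auto intro: prev\<close>)
      ultimately show ?thesis ..
    qed (simp add: U V)
  qed
qed

theorem proposition4:
  fixes n :: nat
  assumes "n \<ge> 9"
  shows "zero_forcing_set (generalized_petersen n 3) (U ` {0..7})
    \<and> zero_forcing_number (generalized_petersen n 3) \<le> 8"
proof
  let ?G = "generalized_petersen n 3" and ?S = "U ` {0..7}"
  have sub: "?S \<subseteq> pverts ?G" using assms by auto
  have "finite (pverts ?G)" by (simp add: generalized_petersen_def)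
  then obtain B where B: "forcing_final ?G ?S B" using forcing_final_exists by blast
  have "pverts ?G \<subseteq> B"
    using forcing_final_petersen3[OF assms B] by (auto simp: generalized_petersen_def)
  with forcing_final_subset_pverts[OF B sub] have "B = pverts ?G" by blast
  with B sub show zfs: "zero_forcing_set ?G ?S"
    by (simp add: zero_forcing_set_def forcing_closure_eqI)
  have "card ?S = 8" by (simp add: card_image inj_on_def)
  with zero_forcing_number_le[OF zfs] show "zero_forcing_number ?G \<le> 8" by simp
qed

end
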